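(* Let $R$ be a ring and let $M$ be an l-finite Euclidean $R$-module with $l_R(M)=\infty$. Then: (1) $M$ is a uniform $R$-module. (2) $M$ is an indecomposable module. (3) $\mathrm{soc}_R(M)=0$. (4) Every nonzero submodule of $M$ is of infinite length. (5) $\mathcal{K}(M)=1$ and $\mathcal{K}(M/N)=0$ for all nonzero submodules $N$ of $M$ (with the convention that this refers to $M/N$ of finite length), i.e. $M$ is a critical $R$-module.
   Context: Rings are unital and modules are left modules; $l_R$ denotes length and $\mathcal{K}$ denotes (Gabriel–Rentschler) Krull dimension of modules. A module is critical if $\mathcal{K}(M/N)<\mathcal{K}(M)$ for all nonzero submodules $N$. A nonzero module is uniform if any two nonzero submodules have nonzero intersection. (In (5), for $N=M$ the factor module is zero, for which $\mathcal{K}$ is conventionally $\le 0$.) A poset is Artinian if every descending chain in it stabilizes. For $i\le j$ in a poset, $[i,j]:=\{k:i\le k\le j\}$ and $l([i,j]):=\sup\{k\in\mathbb{N}:\text{there is a chain } i=i_1<\cdots<i_k=j\}$. An $R$-module $M$ is a Euclidean module if there is a function $d_M:M\setminus\{0\}\to P$ to a poset $(P,\ge)$ such that $\mathrm{im}(d_M)$ is an Artinian poset and, for any nonzero $u,v\in M$, there are $q\in R$ and $r\in M$ with $u=qv+r$ and either $r=0$ or $d_M(r)<d_M(v)$. For a nonzero submodule $N\subseteq M$, $g(N):=\min\{d_M(x):0\neq x\in N\}$ (the least value; it is presupposed to exist). $M$ is l-finite if every interval in the poset $\mathrm{im}(d_M)$ has finite length, equivalently $l([g(M),d_M(m)])<\infty$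 for all nonzero $m\in M$. *)

theory Defs
  imports
    "HOL-Algebra.Module"
    "HOL-Algebra.AbelCoset"
    "HOL-Library.Extended_Nat"
    "HOL-Library.Option_ord"
begin

section \<open>Left modules over a not necessarily commutative ring\<close>

text \<open>The locale \<^locale>\<open>module\<close> requires a commutative ring of scalars; the following is the
  same list of axioms over an arbitrary (unital) ring.  The locale \<^locale>\<open>submodule\<close> does
  not involve commutativity and is used as it is.\<close>

locale left_module = R?: ring R + M?: abelian_group M
  for R :: "('r, 'x) ring_scheme" (structure) and M :: "('r, 'm, 'y) module_scheme" (structure) +
  assumes smult_closed [simp, intro]:
      "\<lbrakk>a \<in> carrier R; x \<in> carrier M\<rbrakk> \<Longrightarrow> a \<odot>\<^bsub>M\<^esub> x \<in> carrier M"
    and smult_l_distr: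
      "\<lbrakk>a \<in> carrier R; b \<in> carrier R; x \<in> carrier M\<rbrakk> \<Longrightarrow>
        (a \<oplus>\<^bsub>R\<^esub> b) \<odot>\<^bsub>M\<^esub> x = a \<odot>\<^bsub>M\<^esub> x \<oplus>\<^bsub>M\<^esub> b \<odot>\<^bsub>M\<^esub> x"
    and smult_r_distr:
      "\<lbrakk>a \<in> carrier R; x \<in> carrier M; y \<in> carrier M\<rbrakk> \<Longrightarrow>
        a \<odot>\<^bsub>M\<^esub> (x \<oplus>\<^bsub>M\<^esub> y) = a \<odot>\<^bsub>M\<^esub> x \<oplus>\<^bsub>M\<^esub> a \<odot>\<^bsub>M\<^esub> y"
    and smult_assoc1:
      "\<lbrakk>a \<in> carrier R; b \<in> carrier R; x \<in> carrier M\<rbrakk> \<Longrightarrow>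
        (a \<otimes>\<^bsub>R\<^esub> b) \<odot>\<^bsub>M\<^esub> x = a \<odot>\<^bsub>M\<^esub> (b \<odot>\<^bsub>M\<^esub> x)"
    and smult_one [simp]:
      "x \<in> carrier M \<Longrightarrow> \<one>\<^bsub>R\<^esub> \<odot>\<^bsub>M\<^esub> x = x"

definition nonzero_submodule ::
    "'m set \<Rightarrow> ('r, 'x) ring_scheme \<Rightarrow> ('r, 'm, 'y) module_scheme \<Rightarrow> bool" where
  "nonzero_submodule N R M \<longleftrightarrow> submodule N R M \<and> N \<noteq> {\<zero>\<^bsub>M\<^esub>}"

text \<open>The factor module of cosets.  The fields \<open>mult\<close> and \<open>one\<close>, which the record type inherits
  from rings, carry no meaning for modules.\<close>

definition quotient_module :: "('r, 'm, 'y) module_scheme \<Rightarrow> 'm set \<Rightarrow> ('r, 'm set) module" where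
  "quotient_module M N =
    \<lparr>carrier = a_rcosets\<^bsub>M\<^esub> N, mult = undefined, one = undefined,
     zero = N, add = set_add M, smult = (\<lambda>a X. \<Union>x\<in>X. N +>\<^bsub>M\<^esub> (a \<odot>\<^bsub>M\<^esub> x))\<rparr>"

definition module_length ::
    "('r, 'x) ring_scheme \<Rightarrow> ('r, 'm, 'y) module_scheme \<Rightarrow> enat" where
  "module_length R M =
    Sup {enat (length Ns - 1) |Ns. Ns \<noteq> [] \<and> sorted_wrt (\<subset>) Ns \<and> (\<forall>N\<in>set Ns. submodule N R M)}"

definition uniform_module ::
    "('r, 'x) ring_scheme \<Rightarrow> ('r, 'm, 'y) module_scheme \<Rightarrow> bool" where
  "uniform_module R M \<longleftrightarrow>
    carrier M \<noteq> {\<zero>\<^bsub>M\<^esub>} \<and>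
    (\<forall>N L. nonzero_submodule N R M \<longrightarrow> nonzero_submodule L R M \<longrightarrow> N \<inter> L \<noteq> {\<zero>\<^bsub>M\<^esub>})"

definition indecomposable_module ::
    "('r, 'x) ring_scheme \<Rightarrow> ('r, 'm, 'y) module_scheme \<Rightarrow> bool" where
  "indecomposable_module R M \<longleftrightarrow>
    carrier M \<noteq> {\<zero>\<^bsub>M\<^esub>} \<and>
    \<not> (\<exists>N L. nonzero_submodule N R M \<and> nonzero_submodule L R M \<and>
            N \<inter> L = {\<zero>\<^bsub>M\<^esub>} \<and> N <+>\<^bsub>M\<^esub> L = carrier M)"

definition simple_submodule ::
    "'m set \<Rightarrow> ('r, 'x) ring_scheme \<Rightarrow> ('r, 'm, 'y) module_scheme \<Rightarrow> bool" where
  "simple_submodule S R M \<longleftrightarrow>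
    nonzero_submodule S R M \<and> (\<forall>N. nonzero_submodule N R M \<longrightarrow> N \<subseteq> S \<longrightarrow> N = S)"

text \<open>The sum of all simple submodules, i.e. the smallest submodule containing them.\<close>

definition socle ::
    "('r, 'x) ring_scheme \<Rightarrow> ('r, 'm, 'y) module_scheme \<Rightarrow> 'm set" where
  "socle R M = \<Inter> {N. submodule N R M \<and> (\<forall>S. simple_submodule S R M \<longrightarrow> S \<subseteq> N)}"


section \<open>Ordinals\<close>

text \<open>The order types of well-orders on subsets of \<open>'a\<close>, that is, the ordinals of cardinality at
  most that of \<open>'a\<close>.\<close>

quotient_type 'a ordinal =
  "'a rel" / partial: "\<lambda>r s. Well_order r \<and> Well_order s \<and> (r, s) \<in> ordIso"
proof (rule part_equivpI)
  show "\<exists>r :: 'a rel. Well_order r \<and> Well_order r \<and> (r, r) \<in> ordIso"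
    by (intro exI[of _ "{}"]) (simp add: ordIso_reflexive)
  show "symp (\<lambda>r s :: 'a rel. Well_order r \<and> Well_order s \<and> (r, s) \<in> ordIso)"
    by (auto intro: sympI ordIso_symmetric)
  show "transp (\<lambda>r s :: 'a rel. Well_order r \<and> Well_order s \<and> (r, s) \<in> ordIso)"
    by (auto intro: transpI ordIso_transitive)
qed

instantiation ordinal :: (type) "{linorder, zero, one}"
begin

lift_definition less_eq_ordinal :: "'a ordinal \<Rightarrow> 'a ordinal \<Rightarrow> bool"
  is "\<lambda>r s. (r, s) \<in> ordLeq"
  by (meson ordIso_iff_ordLeq ordLeq_transitive)

definition less_ordinal :: "'a ordinal \<Rightarrow> 'a ordinal \<Rightarrow> bool" where
  "less_ordinal a b \<longleftrightarrow> a \<le> b \<and> \<not> b \<le> a"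

lift_definition zero_ordinal :: "'a ordinal" is "{}"
  by (simp add: ordIso_reflexive)

lift_definition one_ordinal :: "'a ordinal" is "{(undefined, undefined)}"
  by (simp add: ordIso_reflexive order_on_defs refl_on_def trans_def antisym_def total_on_def)

instance
proof
  fix a b c :: "'a ordinal"
  show "a < b \<longleftrightarrow> a \<le> b \<and> \<not> b \<le> a" by (rule less_ordinal_def)
  show "a \<le> a" by transfer (simp add: ordLeq_reflexive)
  show "a \<le> b \<Longrightarrow> b \<le> c \<Longrightarrow> a \<le> c" by transfer (rule ordLeq_transitive)
  show "a \<le> b \<Longrightarrow> b \<le> a \<Longrightarrow> a = b" by transfer (simp add: ordIso_iff_ordLeq)
  show "a \<le> b \<or> b \<le> a" by transfer (simp add: ordLeq_total)
qed

end

instance ordinal :: (type) wellorder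
proof
  fix P :: "'a ordinal \<Rightarrow> bool" and a :: "'a ordinal"
  assume step: "\<And>a. (\<And>b. b < a \<Longrightarrow> P b) \<Longrightarrow> P a"
  have "\<forall>r. Well_order r \<longrightarrow> P (abs_ordinal r)"
  proof
    fix r :: "'a rel"
    show "Well_order r \<longrightarrow> P (abs_ordinal r)"
    proof (induction r rule: wf_induct_rule[OF wf_ordLess])
      case (1 r)
      show ?case
      proof
        assume r: "Well_order r"
        show "P (abs_ordinal r)"
        proof (rule step)
          fix b assume b: "b < abs_ordinal r"
          obtain s where s: "Well_order s" "b = abs_ordinal s"
            using Quotient3_abs_rep[OF Quotient3_ordinal] Quotient3_rep_reflp[OF Quotient3_ordinal]
            by metis
          have "\<not> (r, s) \<in> ordLeq"
            using b r s less_eq_ordinal.abs_eq[of r s]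
            by (auto simp: eq_onp_def less_ordinal_def ordIso_reflexive)
          then have "(s, r) \<in> ordLess"
            using r s(1) by (simp add: not_ordLeq_iff_ordLess)
          then show "P b" using 1 s by blast
        qed
      qed
    qed
  qed
  then show "P a"
    using Quotient3_abs_rep[OF Quotient3_ordinal] Quotient3_rep_reflp[OF Quotient3_ordinal] by metis
qed

lemma zero_le_ordinal [simp]: "0 \<le> (a :: 'a ordinal)"
proof transfer
  fix r :: "'a rel"
  assume r: "Well_order r \<and> Well_order r \<and> (r, r) \<in> ordIso"
  have "\<not> (r, {} :: 'a rel) \<in> ordLess"
    using internalize_ordLess[of r "{} :: 'a rel"] by auto
  then show "({} :: 'a rel, r) \<in> ordLeq"
    using r not_ordLess_iff_ordLeq[of "{} :: 'a rel" r] by simp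
qed

lemma less_one_ordinal_iff [simp]: "a < 1 \<longleftrightarrow> a = (0 :: 'a ordinal)"
proof
  have "\<not> ({(undefined, undefined)} :: 'a rel, {} :: 'a rel) \<in> ordLeq"
  proof
    assume "({(undefined, undefined)} :: 'a rel, {} :: 'a rel) \<in> ordLeq"
    then obtain f :: "'a \<Rightarrow> 'a" where "embed {(undefined, undefined)} {} f"
      unfolding ordLeq_def by blast
    then have "f ` Field {(undefined, undefined)} \<subseteq> Field {}"
      by (intro embed_Field) (simp_all add: order_on_defs refl_on_def trans_def antisym_def total_on_def)
    then show False by (simp add: Field_def)
  qed
  then have "\<not> (1 :: 'a ordinal) \<le> 0" by transfer
  then show "a < 1" if "a = 0" using that by simp
next
  have *: "(r, {} :: 'a rel) \<in> ordIso"
    if r: "Well_order r" "\<not> ({(undefined, undefined)} :: 'a rel, r) \<in> ordLeq" for r :: "'a rel"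
  proof -
    have "Well_order ({(undefined, undefined)} :: 'a rel)"
      by (simp add: order_on_defs refl_on_def trans_def antisym_def total_on_def)
    then have "(r, {(undefined, undefined)} :: 'a rel) \<in> ordLess"
      using r by (simp add: not_ordLeq_iff_ordLess)
    then obtain p :: "'a rel" where p: "Field p \<subset> {undefined}" "(r, p) \<in> ordIso"
      using internalize_ordLess[of r "{(undefined, undefined)} :: 'a rel"] by (auto simp: Field_def)
    then have "p = {}" by (auto simp: Field_def)
    with p show ?thesis by simp
  qed
  have "a = 0" if "\<not> 1 \<le> a"
    using that
  proof transfer
    fix r :: "'a rel"
    assume "Well_order r \<and> Well_order r \<and> (r, r) \<in> ordIso"
      and "\<not> ({(undefined, undefined)} :: 'a rel, r) \<in> ordLeq"
    with *[of r] show "Well_order r \<and> Well_order ({} :: 'a rel) \<and> (r, {} :: 'a rel) \<in> ordIso"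
      by simp
  qed
  then show "a = 0" if "a < 1" using that by auto
qed


section \<open>Krull dimension\<close>

text \<open>\<open>has_deviation \<delta> A\<close>: the deviation of the poset \<open>A\<close> exists and equals \<open>\<delta>\<close>.  Values
  are \<^term>\<open>None\<close>, standing for \<open>-\<infinity>\<close>, which lies below everything else and is the deviation of
  a trivial poset, and \<^term>\<open>Some \<alpha>\<close> for an ordinal \<open>\<alpha>\<close>.\<close>

function has_deviation :: "'o::wellorder option \<Rightarrow> 'a::order set \<Rightarrow> bool" where
  "has_deviation \<delta> A \<longleftrightarrow>
    (\<forall>\<epsilon>\<in>{..<\<delta>}. \<not> has_deviation \<epsilon> A) \<and>
    (if \<delta> = None then \<forall>x\<in>A. \<forall>y\<in>A. x \<le> y \<longrightarrow> x = y
     else \<forall>f :: nat \<Rightarrow> 'a. range f \<subseteq> A \<and> antimono f \<longrightarrow>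
       (\<exists>n. \<forall>i\<ge>n. \<exists>\<epsilon>\<in>{..<\<delta>}. has_deviation \<epsilon> {x \<in> A. f (Suc i) \<le> x \<and> x \<le> f i}))"
  by pat_completeness auto
termination
  by (relation "{(\<epsilon>, \<delta>). \<epsilon> < \<delta>} <*lex*> {}") (simp_all add: wf_lex_prod wf)

declare has_deviation.simps [simp del]

text \<open>Since subquotients of \<open>M\<close> have the intervals of the lattice of submodules of \<open>M\<close> as their
  lattices of submodules, the Krull dimension of \<open>M\<close> is the deviation of that lattice.\<close>

definition has_krull_dim ::
    "('r, 'x) ring_scheme \<Rightarrow> ('r, 'm, 'y) module_scheme \<Rightarrow> 'o::wellorder option \<Rightarrow> bool" where
  "has_krull_dim R M \<delta> \<longleftrightarrow> has_deviation \<delta> {N. submodule N R M}"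

text \<open>An infinite module with carrier in \<open>'m\<close> has at most \<open>|'m set|\<close> submodules, and a deviation
  of a poset \<open>A\<close> has at most as many predecessors as \<open>A\<close> has intervals.  Hence the ordinals of
  cardinality at most \<open>|'m set|\<close> suffice for \<open>M\<close> and its factor modules.\<close>

definition critical_module ::
    "('r, 'x) ring_scheme \<Rightarrow> ('r, 'm, 'y) module_scheme \<Rightarrow> bool" where
  "critical_module R M \<longleftrightarrow>
    (\<exists>\<delta> :: 'm set ordinal option. has_krull_dim R M \<delta> \<and>
      (\<forall>N. nonzero_submodule N R M \<longrightarrow>
        (\<exists>\<epsilon>. \<epsilon> < \<delta> \<and> has_krull_dim R (quotient_module M N) \<epsilon>)))"


section \<open>Euclidean modules\<close>

definition artinian_poset :: "'p::order set \<Rightarrow> bool" where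
  "artinian_poset A \<longleftrightarrow>
    (\<forall>f :: nat \<Rightarrow> 'p. range f \<subseteq> A \<and> antimono f \<longrightarrow> (\<exists>n. \<forall>m\<ge>n. f m = f n))"

text \<open>As a chain \<open>i = i\<^sub>1 < \<dots> < i\<^sub>k = j\<close> counts with its number \<open>k\<close> of elements, the length of
  \<open>[i, i]\<close> is \<open>1\<close>, in contrast to \<^const>\<open>module_length\<close>.\<close>

definition interval_length :: "'p::order set \<Rightarrow> 'p \<Rightarrow> 'p \<Rightarrow> enat" where
  "interval_length A i j =
    Sup {enat (length xs) |xs.
      xs \<noteq> [] \<and> set xs \<subseteq> A \<and> sorted_wrt (<) xs \<and> hd xs = i \<and> last xs = j}"

definition euclidean_function ::
    "('r, 'x) ring_scheme \<Rightarrow> ('r, 'm, 'y) module_scheme \<Rightarrow> ('m \<Rightarrow> 'p::order) \<Rightarrow> bool" where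
  "euclidean_function R M d \<longleftrightarrow>
    artinian_poset (d ` (carrier M - {\<zero>\<^bsub>M\<^esub>})) \<and>
    (\<forall>u \<in> carrier M - {\<zero>\<^bsub>M\<^esub>}. \<forall>v \<in> carrier M - {\<zero>\<^bsub>M\<^esub>}.
      \<exists>q \<in> carrier R. \<exists>r \<in> carrier M.
        u = q \<odot>\<^bsub>M\<^esub> v \<oplus>\<^bsub>M\<^esub> r \<and> (r = \<zero>\<^bsub>M\<^esub> \<or> d r < d v))"

text \<open>\<open>is_g M d N p\<close>: the values of \<open>d\<close> on the nonzero elements of \<open>N\<close> have a least element,
  namely \<open>p\<close>.\<close>

definition is_g :: "('r, 'm, 'y) module_scheme \<Rightarrow> ('m \<Rightarrow> 'p::order) \<Rightarrow> 'm set \<Rightarrow> 'p \<Rightarrow> bool" where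
  "is_g M d N p \<longleftrightarrow>
    p \<in> d ` (N - {\<zero>\<^bsub>M\<^esub>}) \<and> (\<forall>x \<in> N - {\<zero>\<^bsub>M\<^esub>}. p \<le> d x)"

text \<open>The existence of \<open>g(M)\<close> does not follow from the finiteness of the intervals.\<close>

definition l_finite :: "('r, 'm, 'y) module_scheme \<Rightarrow> ('m \<Rightarrow> 'p::order) \<Rightarrow> bool" where
  "l_finite M d \<longleftrightarrow>
    (\<exists>p. is_g M d (carrier M) p) \<and>
    (let A = d ` (carrier M - {\<zero>\<^bsub>M\<^esub>})
     in \<forall>i\<in>A. \<forall>j\<in>A. i \<le> j \<longrightarrow> interval_length A i j < \<infinity>)"

end

theory Submission
  imports Defs
begin

text \<open>For submodules \<open>N \<subset> L\<close> and \<open>0 \<noteq> v \<in> N\<close>, dividing some \<open>u \<in> L - N\<close> by \<open>v\<close> leaves a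
  remainder \<open>r \<in> L - N\<close> with \<open>d r < d v\<close>.  Hence a chain of submodules that contain \<open>v\<close> produces
  a chain, equally long, in the interval from \<open>g(M)\<close> to \<open>d v\<close>.  So \<open>M/N\<close> has finite length for
  every nonzero \<open>N\<close>, and all claims follow from this and \<open>l(M) = \<infinity>\<close> by the modular law.\<close>

section \<open>Posets of finite height\<close>

text \<open>A uniform bound on finite chains also excludes infinite ones, since these have finite
  subchains of every size.\<close>

definition finite_height :: "'a::order set \<Rightarrow> bool" where
  "finite_height A \<longleftrightarrow>
    (\<exists>b. \<forall>C\<subseteq>A. finite C \<longrightarrow> Complete_Partial_Order.chain (\<le>) C \<longrightarrow> card C \<le> b)"

lemma finite_height_subset: "finite_height B \<Longrightarrow> A \<subseteq> B \<Longrightarrow> finite_height A"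
  unfolding finite_height_def by (meson subset_trans)

lemma finite_height_finite: "finite A \<Longrightarrow> finite_height A"
  unfolding finite_height_def by (meson card_mono)

text \<open>Elements of a chain \<open>D\<close> are comparable, so
  \<open>x \<mapsto> (f x, g x)\<close> is injective on \<open>D\<close> and embeds it into the
  product of two chains of bounded size. The crude bound \<open>b * c\<close> is enough.\<close>

lemma finite_height_joint_map:
  fixes f :: "'a::order \<Rightarrow> 'b::order" and g :: "'a \<Rightarrow> 'c::order"
  assumes B: "finite_height B" "f ` A \<subseteq> B" "mono_on A f"
    and C: "finite_height C" "g ` A \<subseteq> C" "mono_on A g"
    and inj: "\<And>x y. x \<in> A \<Longrightarrow> y \<in> A \<Longrightarrow> x \<le> y \<Longrightarrow> f x = f y \<Longrightarrow> g x = g y \<Longrightarrow> x = y"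
  shows "finite_height A"
proof -
  obtain b where b: "\<And>D. D \<subseteq> B \<Longrightarrow> finite D \<Longrightarrow> Complete_Partial_Order.chain (\<le>) D \<Longrightarrow> card D \<le> b"
    using B(1) unfolding finite_height_def by blast
  obtain c where c: "\<And>D. D \<subseteq> C \<Longrightarrow> finite D \<Longrightarrow> Complete_Partial_Order.chain (\<le>) D \<Longrightarrow> card D \<le> c"
    using C(1) unfolding finite_height_def by blast
  have "card D \<le> b * c" if D: "D \<subseteq> A" "finite D" "Complete_Partial_Order.chain (\<le>) D" for D
  proof -
    have "Complete_Partial_Order.chain (\<le>) (f ` D)" "Complete_Partial_Order.chain (\<le>) (g ` D)"
      using D B(3) C(3) unfolding chain_def mono_on_def by blast+
    then have "card (f ` D) \<le> b" "card (g ` D) \<le> c"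
      using b[of "f ` D"] c[of "g ` D"] D B(2) C(2) by auto
    moreover have "inj_on (\<lambda>x. (f x, g x)) D"
    proof (rule inj_onI)
      fix x y assume xy: "x \<in> D" "y \<in> D" "(f x, g x) = (f y, g y)"
      then have "x \<le> y \<or> y \<le> x"
        using D(3) by (simp add: chain_def)
      then show "x = y"
        using inj[of x y] inj[of y x] xy D(1) by auto
    qed
    then have "card D \<le> card (f ` D \<times> g ` D)"
      using D(2) by (intro card_inj_on_le) auto
    ultimately show ?thesis
      by (metis card_cartesian_product le_trans mult_le_mono)
  qed
  then show ?thesis
    unfolding finite_height_def by blast
qed

text \<open>The case of one strictly monotone map, obtained by taking \<open>f\<close> for both
  coordinates.\<close>

lemma finite_height_map:
  fixes f :: "'a::order \<Rightarrow> 'b::order"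
  assumes "finite_height B" "f ` A \<subseteq> B" "mono_on A f"
    and "\<And>x y. x \<in> A \<Longrightarrow> y \<in> A \<Longrightarrow> x \<le> y \<Longrightarrow> f x = f y \<Longrightarrow> x = y"
  shows "finite_height A"
  by (rule finite_height_joint_map[OF assms(1-3) assms(1-3)]) (use assms(4) in blast)

section \<open>Finite chains as sorted lists\<close>

lemma finite_chain_sorted_list:
  fixes C :: "'a::order set"
  assumes "finite C" "Complete_Partial_Order.chain (\<le>) C"
  obtains xs where "set xs = C" "sorted_wrt (<) xs"
proof -
  have "\<exists>xs. set xs = C \<and> sorted_wrt (<) xs"
    using assms
  proof (induction C rule: finite_psubset_induct)
    case (psubset C)
    show ?case
    proof (cases "C = {}")
      case False
      \<comment> \<open>In a chain a maximal element is greatest, so \<open>m\<close> becomes the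
        last entry.\<close>
      then obtain m where m: "m \<in> C" "\<And>y. y \<in> C \<Longrightarrow> m \<le> y \<Longrightarrow> m = y"
        using finite_has_maximal[OF psubset.hyps] by blast
      have "Complete_Partial_Order.chain (\<le>) (C - {m})"
        using psubset.prems unfolding chain_def by blast
      then obtain xs where xs: "set xs = C - {m}" "sorted_wrt (<) xs"
        using psubset.IH[of "C - {m}"] m(1) by blast
      have "x < m" if "x \<in> C - {m}" for x
        using that m psubset.prems unfolding chain_def by (metis Diff_iff insertI1 order_le_less)
      then show ?thesis
        using xs m(1) by (intro exI[of _ "xs @ [m]"]) (auto simp: sorted_wrt_append)
    qed auto
  qed
  then show thesis using that by blast
qed

lemma sorted_wrt_less_chain:
  fixes xs :: "'a::order list"
  assumes "sorted_wrt (<) xs"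
  shows "distinct xs" "Complete_Partial_Order.chain (\<le>) (set xs)"
  using assms by (induction xs) (auto simp: chain_def less_imp_le)

text \<open>Turns bounds for strictly increasing lists, the form used in
  \<open>module_length\<close> and \<open>interval_length\<close>, into bounds for chains.\<close>

lemma finite_heightI_sorted_list:
  fixes A :: "'a::order set"
  assumes "\<And>xs. set xs \<subseteq> A \<Longrightarrow> sorted_wrt (<) xs \<Longrightarrow> length xs \<le> b"
  shows "finite_height A"
  unfolding finite_height_def
proof (intro exI allI impI)
  fix C :: "'a set"
  assume C: "C \<subseteq> A" "finite C" "Complete_Partial_Order.chain (\<le>) C"
  obtain xs where "set xs = C" "sorted_wrt (<) xs"
    using finite_chain_sorted_list[OF C(2,3)] .
  then show "card C \<le> b"
    using assms[of xs] C(1) card_length[of xs] by simp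
qed

section \<open>The descending chain condition\<close>

lemma artinian_poset_minimal:
  assumes "artinian_poset A" "B \<subseteq> A" "B \<noteq> {}"
  shows "\<exists>m\<in>B. \<forall>y\<in>B. \<not> y < m"
proof (rule ccontr)
  assume "\<not> ?thesis"
  then have "\<forall>x\<in>B. \<exists>y\<in>B. y < x" by blast
  \<comment> \<open>Iterating a choice of smaller elements produces a strictly decreasing
    sequence.\<close>
  then obtain h where h: "\<And>x. x \<in> B \<Longrightarrow> h x \<in> B \<and> h x < x" by metis
  obtain x where "x \<in> B" using assms(3) by blast
  define f where "f n = (h ^^ n) x" for n
  have f: "f n \<in> B" for n
    using h \<open>x \<in> B\<close> by (induction n) (auto simp: f_def)
  have dec: "f (Suc n) < f n" for n
    using h[OF f[of n]] by (simp add: f_def)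
  have "antimono f"
    using dec less_imp_le by (intro decseq_SucI) blast
  moreover have "range f \<subseteq> A"
    using f assms(2) by blast
  ultimately obtain n where "\<forall>m\<ge>n. f m = f n"
    using assms(1) unfolding artinian_poset_def by blast
  then have "f (Suc n) = f n"
    by (meson le_SucI order_refl)
  then show False
    using dec[of n] by simp
qed

text \<open>The range of a descending sequence is a chain, hence finite here, and the sequence is
  constant once it reaches the minimum of its range.\<close>

lemma finite_height_artinian:
  fixes A :: "'a::order set"
  assumes "finite_height A"
  shows "artinian_poset A"
  unfolding artinian_poset_def
proof (intro allI impI)
  fix f :: "nat \<Rightarrow> 'a"
  assume f: "range f \<subseteq> A \<and> antimono f"
  obtain b where b: "\<And>D. D \<subseteq> A \<Longrightarrow> finite D \<Longrightarrow> Complete_Partial_Order.chain (\<le>) D \<Longrightarrow> card D \<le> b"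
    using assms unfolding finite_height_def by blast
  have chain: "Complete_Partial_Order.chain (\<le>) (range f)"
    using f unfolding chain_def antimono_def by (metis imageE nat_le_linear)
  have "finite (range f)"
  proof (rule ccontr)
    assume "infinite (range f)"
    then obtain D where D: "D \<subseteq> range f" "finite D" "card D = Suc b"
      using infinite_arbitrarily_large by metis
    have "D \<subseteq> A"
      using D(1) f by (blast intro: subset_trans)
    moreover have "Complete_Partial_Order.chain (\<le>) D"
      using chain D(1) by (rule chain_subset)
    ultimately have "card D \<le> b"
      using b D(2) by blast
    then show False using D by simp
  qed
  then obtain x where x: "x \<in> range f" "\<forall>y\<in>range f. y \<le> x \<longrightarrow> x = y"
    using finite_has_minimal[of "range f"] by auto
  then obtain n where n: "x = f n" by blast
  have "f m = f n" if "m \<ge> n" for m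
    using x(2) n antimonoD[of f n m] f that by auto
  then have "\<forall>m\<ge>n. f m = f n" by blast
  then show "\<exists>n. \<forall>m\<ge>n. f m = f n" ..
qed


section \<open>Deviations up to one\<close>

lemma has_deviation_None_iff:
  "has_deviation (None :: 'o::wellorder option) A \<longleftrightarrow> (\<forall>x\<in>A. \<forall>y\<in>A. x \<le> y \<longrightarrow> x = y)"
  by (subst has_deviation.simps) auto

text \<open>This and the next lemma turn the recursive quantifier over smaller deviations into one
  over an explicit finite set.\<close>

lemma lessThan_Some_0_ordinal: "{..<Some (0 :: 'a ordinal)} = {None}"
  by (auto simp: less_option_def leD[OF zero_le_ordinal] split: option.splits)

lemma lessThan_Some_1_ordinal: "{..<Some (1 :: 'a ordinal)} = {None, Some 0}"
  by (auto simp: less_option_def split: option.splits)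

text \<open>Both endpoints of the interval from \<open>f (Suc i)\<close> to \<open>f i\<close> lie
  in \<open>A\<close> and are comparable, so the interval is trivial exactly when they coincide.
  Eventual triviality is thus stabilization of \<open>f\<close>.\<close>

lemma has_deviation_0_iff:
  "has_deviation (Some (0 :: 'o ordinal)) A \<longleftrightarrow>
    \<not> has_deviation (None :: 'o ordinal option) A \<and> artinian_poset A"
proof -
  have "(\<exists>n. \<forall>i\<ge>n. has_deviation (None :: 'o ordinal option) {x \<in> A. f (Suc i) \<le> x \<and> x \<le> f i}) \<longleftrightarrow>
      (\<exists>n. \<forall>m\<ge>n. f m = f n)"
    if f: "range f \<subseteq> A" "antimono f" for f :: "nat \<Rightarrow> 'a"
  proof -
    have "has_deviation (None :: 'o ordinal option) {x \<in> A. f (Suc i) \<le> x \<and> x \<le> f i} \<longleftrightarrow>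
        f (Suc i) = f i" for i
    proof -
      have "f (Suc i) \<le> f i" "f (Suc i) \<in> A" "f i \<in> A"
        using f by (auto simp: antimono_def)
      then show ?thesis
        unfolding has_deviation_None_iff by auto
    qed
    moreover have "(\<exists>n. \<forall>i\<ge>n. f (Suc i) = f i) \<longleftrightarrow> (\<exists>n. \<forall>m\<ge>n. f m = f n)"
    proof
      assume "\<exists>n. \<forall>i\<ge>n. f (Suc i) = f i"
      then obtain n where n: "\<forall>i\<ge>n. f (Suc i) = f i" by blast
      have "f m = f n" if "m \<ge> n" for m
        using that n by (induction m rule: dec_induct) auto
      then show "\<exists>n. \<forall>m\<ge>n. f m = f n" by blast
    next
      assume "\<exists>n. \<forall>m\<ge>n. f m = f n"
      then show "\<exists>n. \<forall>i\<ge>n. f (Suc i) = f i"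
        by (metis le_SucI)
    qed
    ultimately show ?thesis by simp
  qed
  then show ?thesis
    unfolding artinian_poset_def
    by (subst has_deviation.simps) (simp add: lessThan_Some_0_ordinal)
qed

text \<open>Failure of the descending chain condition rules out the values \<open>None\<close> and
  \<open>Some 0\<close> for \<open>A\<close>, while each interval that satisfies it has one of these
  values. The recursion thus reduces to chain conditions.\<close>

lemma has_deviation_1I:
  assumes "\<not> artinian_poset A"
    and "\<And>f. range f \<subseteq> A \<Longrightarrow> antimono f \<Longrightarrow>
      \<exists>n. \<forall>i\<ge>n. artinian_poset {x \<in> A. f (Suc i) \<le> x \<and> x \<le> f i}"
  shows "has_deviation (Some (1 :: 'o ordinal)) A"
proof -
  have "\<not> has_deviation (None :: 'o ordinal option) A"
  proof
    assume triv: "has_deviation (None :: 'o ordinal option) A"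
    \<comment> \<open>In a trivial order \<open>f m \<le> f 0\<close> is an equality, so descending
      sequences are constant.\<close>
    have "f m = f 0" if "range f \<subseteq> A \<and> antimono f" for f :: "nat \<Rightarrow> 'a" and m
      using triv that unfolding has_deviation_None_iff antimono_def by blast
    then have "artinian_poset A"
      unfolding artinian_poset_def by blast
    then show False using assms(1) by blast
  qed
  moreover have "\<not> has_deviation (Some (0 :: 'o ordinal)) A"
    using assms(1) has_deviation_0_iff by blast
  \<comment> \<open>The value is \<open>None\<close> if \<open>B\<close> is trivial and
    \<open>Some 0\<close> otherwise.\<close>
  moreover have "\<exists>\<epsilon>\<in>{None, Some (0 :: 'o ordinal)}. has_deviation \<epsilon> B" if "artinian_poset B" for B :: "'a set"
    using that has_deviation_0_iff by blast
  then have "\<exists>n. \<forall>i\<ge>n. \<exists>\<epsilon>\<in>{None, Some (0 :: 'o ordinal)}.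
      has_deviation \<epsilon> {x \<in> A. f (Suc i) \<le> x \<and> x \<le> f i}"
    if "range f \<subseteq> A \<and> antimono f" for f
    using assms(2)[of f] that by meson
  ultimately show ?thesis
    by (subst has_deviation.simps) (simp only: lessThan_Some_1_ordinal, simp)
qed


section \<open>Submodules of left modules\<close>

context left_module
begin

lemma smult_zero_left: "x \<in> carrier M \<Longrightarrow> \<zero>\<^bsub>R\<^esub> \<odot>\<^bsub>M\<^esub> x = \<zero>\<^bsub>M\<^esub>"
  using smult_l_distr[of "\<zero>\<^bsub>R\<^esub>" "\<zero>\<^bsub>R\<^esub>" x] M.add.l_cancel_one'
  by (metis R.add.one_closed R.add.r_one smult_closed)

lemma smult_zero_right: "a \<in> carrier R \<Longrightarrow> a \<odot>\<^bsub>M\<^esub> \<zero>\<^bsub>M\<^esub> = \<zero>\<^bsub>M\<^esub>"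
  using smult_r_distr[of a "\<zero>\<^bsub>M\<^esub>" "\<zero>\<^bsub>M\<^esub>"] M.add.l_cancel_one'
  by (metis M.add.one_closed M.add.r_one smult_closed)

lemma smult_minus_one: "x \<in> carrier M \<Longrightarrow> (\<ominus>\<^bsub>R\<^esub> \<one>\<^bsub>R\<^esub>) \<odot>\<^bsub>M\<^esub> x = \<ominus>\<^bsub>M\<^esub> x"
  using smult_l_distr[of "\<ominus>\<^bsub>R\<^esub> \<one>\<^bsub>R\<^esub>" "\<one>\<^bsub>R\<^esub>" x] smult_zero_left[of x]
  by (metis M.minus_equality R.add.inv_closed R.l_neg R.one_closed smult_closed smult_one)

text \<open>Closure under negatives comes from scalar multiplication by the negative of
  \<open>\<one>\<close>.\<close>

lemma submoduleI:
  assumes "H \<subseteq> carrier M" "\<zero>\<^bsub>M\<^esub> \<in> H"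
    and "\<And>x y. x \<in> H \<Longrightarrow> y \<in> H \<Longrightarrow> x \<oplus>\<^bsub>M\<^esub> y \<in> H"
    and smult: "\<And>a x. a \<in> carrier R \<Longrightarrow> x \<in> H \<Longrightarrow> a \<odot>\<^bsub>M\<^esub> x \<in> H"
  shows "submodule H R M"
proof -
  have "\<ominus>\<^bsub>M\<^esub> x \<in> H" if "x \<in> H" for x
    using that assms(1) smult[of "\<ominus>\<^bsub>R\<^esub> \<one>\<^bsub>R\<^esub>" x] smult_minus_one[of x] by auto
  then show ?thesis
    using assms by (intro submodule.intro subgroup.intro submodule_axioms.intro) (auto simp: a_inv_def)
qed

lemma submoduleD:
  assumes "submodule H R M"
  shows "H \<subseteq> carrier M" "\<zero>\<^bsub>M\<^esub> \<in> H"
    and "\<And>x y. x \<in> H \<Longrightarrow> y \<in> H \<Longrightarrow> x \<oplus>\<^bsub>M\<^esub> y \<in> H"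
    and "\<And>x. x \<in> H \<Longrightarrow> \<ominus>\<^bsub>M\<^esub> x \<in> H"
    and "\<And>a x. a \<in> carrier R \<Longrightarrow> x \<in> H \<Longrightarrow> a \<odot>\<^bsub>M\<^esub> x \<in> H"
proof -
  interpret H: submodule H R M by fact
  show "H \<subseteq> carrier M" "\<zero>\<^bsub>M\<^esub> \<in> H"
    using H.subset H.one_closed by simp_all
  show "x \<oplus>\<^bsub>M\<^esub> y \<in> H" if "x \<in> H" "y \<in> H" for x y
    using H.m_closed[OF that] by simp
  show "\<ominus>\<^bsub>M\<^esub> x \<in> H" if "x \<in> H" for x
    using H.m_inv_closed[OF that] by (simp add: a_inv_def)
  show "a \<odot>\<^bsub>M\<^esub> x \<in> H" if "a \<in> carrier R" "x \<in> H" for a x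
    using H.smult_closed[OF that] .
qed

lemma zero_submodule: "submodule {\<zero>\<^bsub>M\<^esub>} R M"
  by (rule submoduleI) (auto simp: smult_zero_right)

lemma carrier_submodule: "submodule (carrier M) R M"
  by (rule submoduleI) auto

lemma submodule_Int:
  assumes "submodule N R M" "submodule L R M"
  shows "submodule (N \<inter> L) R M"
  using submoduleD[OF assms(1)] submoduleD[OF assms(2)] by (intro submoduleI) auto

lemma mem_set_add: "z \<in> N <+>\<^bsub>M\<^esub> L \<longleftrightarrow> (\<exists>x\<in>N. \<exists>y\<in>L. z = x \<oplus>\<^bsub>M\<^esub> y)"
  by (auto simp: set_add_def')

lemma submodule_set_add:
  assumes "submodule N R M" "submodule L R M"
  shows "submodule (N <+>\<^bsub>M\<^esub> L) R M" "N \<subseteq> N <+>\<^bsub>M\<^esub> L" "L \<subseteq> N <+>\<^bsub>M\<^esub> L"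
proof -
  note N = submoduleD[OF assms(1)] and L = submoduleD[OF assms(2)]
  show "submodule (N <+>\<^bsub>M\<^esub> L) R M"
  proof (rule submoduleI)
    show "N <+>\<^bsub>M\<^esub> L \<subseteq> carrier M"
      using N(1) L(1) M.add.m_closed unfolding mem_set_add subset_iff by blast
    show "\<zero>\<^bsub>M\<^esub> \<in> N <+>\<^bsub>M\<^esub> L"
      using N(2) L(2) M.r_zero[OF M.zero_closed] unfolding mem_set_add by force
    show "u \<oplus>\<^bsub>M\<^esub> v \<in> N <+>\<^bsub>M\<^esub> L" if uv: "u \<in> N <+>\<^bsub>M\<^esub> L" "v \<in> N <+>\<^bsub>M\<^esub> L" for u v
    proof -
      obtain x y x' y' where xy: "x \<in> N" "y \<in> L" "u = x \<oplus>\<^bsub>M\<^esub> y" "x' \<in> N" "y' \<in> L" "v = x' \<oplus>\<^bsub>M\<^esub> y'"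
        using uv by (auto simp: mem_set_add)
      then have "x \<in> carrier M" "y \<in> carrier M" "x' \<in> carrier M" "y' \<in> carrier M"
        using N(1) L(1) by auto
      then have "u \<oplus>\<^bsub>M\<^esub> v = (x \<oplus>\<^bsub>M\<^esub> x') \<oplus>\<^bsub>M\<^esub> (y \<oplus>\<^bsub>M\<^esub> y')"
        using xy by (simp add: M.a_ac)
      then show ?thesis
        using xy N(3) L(3) unfolding mem_set_add by blast
    qed
    show "a \<odot>\<^bsub>M\<^esub> u \<in> N <+>\<^bsub>M\<^esub> L" if "a \<in> carrier R" "u \<in> N <+>\<^bsub>M\<^esub> L" for a u
    proof -
      obtain x y where xy: "x \<in> N" "y \<in> L" "u = x \<oplus>\<^bsub>M\<^esub> y"
        using \<open>u \<in> N <+>\<^bsub>M\<^esub> L\<close> by (auto simp: mem_set_add)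
      then have "a \<odot>\<^bsub>M\<^esub> u = a \<odot>\<^bsub>M\<^esub> x \<oplus>\<^bsub>M\<^esub> a \<odot>\<^bsub>M\<^esub> y"
        using smult_r_distr[OF that(1)] N(1) L(1) by blast
      then show ?thesis
        using xy N(5)[OF that(1)] L(5)[OF that(1)] unfolding mem_set_add by blast
    qed
  qed
  show "N \<subseteq> N <+>\<^bsub>M\<^esub> L"
  proof
    fix x assume "x \<in> N"
    moreover from this have "x = x \<oplus>\<^bsub>M\<^esub> \<zero>\<^bsub>M\<^esub>"
      using N(1) by (simp add: subsetD)
    ultimately show "x \<in> N <+>\<^bsub>M\<^esub> L"
      using L(2) unfolding mem_set_add by blast
  qed
  show "L \<subseteq> N <+>\<^bsub>M\<^esub> L"
  proof
    fix x assume "x \<in> L"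
    moreover from this have "x = \<zero>\<^bsub>M\<^esub> \<oplus>\<^bsub>M\<^esub> x"
      using L(1) by (simp add: subsetD)
    ultimately show "x \<in> N <+>\<^bsub>M\<^esub> L"
      using N(2) unfolding mem_set_add by blast
  qed
qed

text \<open>If \<open>y = x \<oplus> n\<close> with \<open>x \<in> X\<close> and
  \<open>n \<in> N\<close>, then \<open>n = \<ominus> x \<oplus> y\<close> lies in
  \<open>Y \<inter> N = X \<inter> N\<close>, so \<open>y \<in> X\<close>. This provides the
  injectivity on comparable pairs that \<open>finite_height_joint_map\<close> asks for.\<close>

lemma modular_law_eq:
  assumes "submodule X R M" "submodule Y R M" "submodule N R M"
    and "X \<subseteq> Y" "X \<inter> N = Y \<inter> N" "X <+>\<^bsub>M\<^esub> N = Y <+>\<^bsub>M\<^esub> N"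
  shows "X = Y"
proof
  note X = submoduleD[OF assms(1)] and Y = submoduleD[OF assms(2)] and N = submoduleD[OF assms(3)]
  show "Y \<subseteq> X"
  proof
    fix y assume y: "y \<in> Y"
    then have "y \<in> X <+>\<^bsub>M\<^esub> N"
      using submodule_set_add(2)[OF assms(2,3)] assms(6) by blast
    then obtain x n where xn: "x \<in> X" "n \<in> N" "y = x \<oplus>\<^bsub>M\<^esub> n"
      by (auto simp: mem_set_add)
    then have "n = \<ominus>\<^bsub>M\<^esub> x \<oplus>\<^bsub>M\<^esub> y"
      using X(1) N(1) by (metis M.r_neg1 subsetD)
    then have "n \<in> Y"
      using xn y assms(4) Y(3,4) by blast
    then show "y \<in> X"
      using xn assms(5) X(3) by blast
  qed
qed (rule assms)

end

text \<open>Stated for bare records, so that it covers \<open>quotient_module M N\<close> and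
  \<open>M\<lparr>carrier := N\<rparr>\<close> as well. Lists of submodules and chains of submodules
  are matched through sorted lists.\<close>

lemma module_length_finite_iff:
  "module_length R M < \<infinity> \<longleftrightarrow> finite_height {N. submodule N R M}"
proof
  assume "module_length R M < \<infinity>"
  then obtain n where n: "module_length R M = enat n"
    by (metis enat_ord_simps(4) less_infinityE)
  \<comment> \<open>\<open>module_length\<close> counts inclusions, one fewer than the entries of
    the list; hence \<open>Suc n\<close>.\<close>
  have "length Ns \<le> Suc n"
    if Ns: "set Ns \<subseteq> {N. submodule N R M}" "sorted_wrt (\<subset>) Ns" for Ns
  proof (cases "Ns = []")
    case False
    then have "enat (length Ns - 1) \<le> module_length R M"
      unfolding module_length_def using Ns by (intro Sup_upper) auto
    then show ?thesis using n by simp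
  qed simp
  then show "finite_height {N. submodule N R M}"
    by (rule finite_heightI_sorted_list)
next
  assume "finite_height {N. submodule N R M}"
  then obtain b where b: "\<And>C. C \<subseteq> {N. submodule N R M} \<Longrightarrow> finite C \<Longrightarrow>
      Complete_Partial_Order.chain (\<subseteq>) C \<Longrightarrow> card C \<le> b"
    unfolding finite_height_def by blast
  have "module_length R M \<le> enat b"
    unfolding module_length_def
  proof (rule Sup_least, clarify)
    fix Ns assume Ns: "sorted_wrt (\<subset>) Ns" "\<forall>N\<in>set Ns. submodule N R M"
    have "card (set Ns) \<le> b"
      using Ns sorted_wrt_less_chain(2)[OF Ns(1)] by (intro b) auto
    then show "enat (length Ns - 1) \<le> enat b"
      using distinct_card[OF sorted_wrt_less_chain(1)[OF Ns(1)]] by simp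
  qed
  then show "module_length R M < \<infinity>"
    using enat_ord_simps(4) order_le_less_trans by blast
qed

context left_module
begin

text \<open>Carries a height bound from the submodule lattice of \<open>N\<close> as a module to the
  interval below \<open>N\<close> in the lattice of \<open>M\<close>.\<close>

lemma submodule_restrict:
  assumes "submodule N R M" "submodule L R M" "L \<subseteq> N"
  shows "submodule L R (M\<lparr>carrier := N\<rparr>)"
proof -
  interpret N: submodule N R M by fact
  interpret L: submodule L R M by fact
  have "subgroup L ((add_monoid M)\<lparr>carrier := N\<rparr>)"
    using group.subgroup_incl[OF M.a_group L.subgroup_axioms N.subgroup_axioms assms(3)] .
  then show ?thesis
    using L.smult_closed by (intro submodule.intro submodule_axioms.intro) auto
qed

section \<open>Cosets and the submodules of a factor module\<close>

context
  fixes N assumes N: "submodule N R M"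
begin

interpretation N: abelian_subgroup N M
  using N M.a_comm_group
  by (intro abelian_subgroupI3 additive_subgroup.intro M.abelian_group_axioms)
    (simp add: submodule.axioms(1))

lemma a_rcosets_nonempty: "c \<in> a_rcosets\<^bsub>M\<^esub> N \<Longrightarrow> c \<noteq> {}"
  using N.a_rcos_self by (auto simp: A_RCOSETS_def')

text \<open>\<open>\<Union>X\<close> is the preimage of \<open>X\<close> under the projection onto
  the factor module.\<close>

lemma submodule_Union_quotient:
  assumes X: "submodule X R (quotient_module M N)"
  shows "submodule (\<Union>X) R M" "N \<subseteq> \<Union>X"
proof -
  interpret X: submodule X R "quotient_module M N" by fact
  have cosets: "X \<subseteq> a_rcosets\<^bsub>M\<^esub> N"
    using X.subset by (simp add: quotient_module_def)
  \<comment> \<open>\<open>N\<close> is the zero of the factor module, hence the unit in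
    \<open>X.one_closed\<close>.\<close>
  have "N \<in> X"
    using X.one_closed by (simp add: quotient_module_def)
  then show "N \<subseteq> \<Union>X" by blast
  have coset: "c = N +>\<^bsub>M\<^esub> x" if "c \<in> X" "x \<in> c" for c x
    using that cosets N.a_repr_independence' N.a_subset
    by (auto simp: A_RCOSETS_def' dest!: subsetD[OF cosets])
  have self: "x \<in> N +>\<^bsub>M\<^esub> x" if "x \<in> carrier M" for x
    using N.a_rcos_self[OF that] .
  have sub: "\<Union>X \<subseteq> carrier M"
    using cosets N.a_rcosets_part_G by blast
  show "submodule (\<Union>X) R M"
  proof (rule submoduleI[OF sub])
    show "\<zero>\<^bsub>M\<^esub> \<in> \<Union>X"
      using \<open>N \<in> X\<close> submoduleD(2)[OF N] by blast
  next
    fix x y assume "x \<in> \<Union>X" "y \<in> \<Union>X"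
    then obtain c c' where c: "c \<in> X" "x \<in> c" "c' \<in> X" "y \<in> c'" by blast
    have xy: "x \<in> carrier M" "y \<in> carrier M"
      using c sub by auto
    have "c <+>\<^bsub>M\<^esub> c' \<in> X"
      using X.m_closed[OF c(1,3)] by (simp add: quotient_module_def)
    moreover have "x \<oplus>\<^bsub>M\<^esub> y \<in> c <+>\<^bsub>M\<^esub> c'"
      using c by (auto simp: mem_set_add)
    ultimately show "x \<oplus>\<^bsub>M\<^esub> y \<in> \<Union>X" by blast
  next
    fix a x assume a: "a \<in> carrier R" and "x \<in> \<Union>X"
    then obtain c where c: "c \<in> X" "x \<in> c" by blast
    \<comment> \<open>\<open>x\<close> itself is one of the representatives in the union defining
      the scalar action, and its term contains \<open>a \<odot> x\<close>.\<close>
    then have "a \<odot>\<^bsub>M\<^esub> x \<in> (\<Union>x\<in>c. N +>\<^bsub>M\<^esub> (a \<odot>\<^bsub>M\<^esub> x))"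
      using self[of "a \<odot>\<^bsub>M\<^esub> x"] a sub by auto
    moreover have "(\<Union>x\<in>c. N +>\<^bsub>M\<^esub> (a \<odot>\<^bsub>M\<^esub> x)) \<in> X"
      using X.smult_closed[OF a c(1)] by (simp add: quotient_module_def)
    ultimately show "a \<odot>\<^bsub>M\<^esub> x \<in> \<Union>X" by blast
  qed
qed

text \<open>\<open>Union\<close> is strictly monotone on sets of cosets, since distinct cosets are
  disjoint and none is empty. Taking preimages therefore transports the bound to the factor
  module.\<close>

lemma finite_height_quotient:
  assumes "finite_height {L. submodule L R M \<and> N \<subseteq> L}"
  shows "finite_height {X. submodule X R (quotient_module M N)}"
proof (rule finite_height_map[OF assms, where f = Union])
  show "Union ` {X. submodule X R (quotient_module M N)} \<subseteq> {L. submodule L R M \<and> N \<subseteq> L}"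
    using submodule_Union_quotient by blast
  show "mono_on {X. submodule X R (quotient_module M N)} Union"
    by (auto simp: mono_on_def)
  fix X Y assume XY: "X \<in> {X. submodule X R (quotient_module M N)}"
      "Y \<in> {X. submodule X R (quotient_module M N)}" "X \<subseteq> Y" "\<Union>X = \<Union>Y"
  have Y: "Y \<subseteq> a_rcosets\<^bsub>M\<^esub> N"
    using submodule.axioms(1)[of Y] subgroup.subset XY(2) by (fastforce simp: quotient_module_def)
  have "c \<in> X" if c: "c \<in> Y" for c
  proof -
    obtain x where x: "x \<in> c"
      using c Y a_rcosets_nonempty by blast
    then obtain c' where c': "c' \<in> X" "x \<in> c'"
      using XY(4) c by blast
    then have "c = c'"
      using x c Y XY(3) N.a_rcos_disjoint unfolding pairwise_def disjnt_def by blast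
    then show ?thesis using c' by simp
  qed
  then show "X = Y" using XY(3) by blast
qed

text \<open>The additive structure agrees, after unfolding, with the factor group
  \<open>M A_Mod N\<close>.\<close>

lemma group_quotient_module: "group (add_monoid (quotient_module M N))"
proof -
  have "group (M A_Mod N)"
    by (rule N.a_factorgroup_is_group)
  then show ?thesis
    unfolding group_def group_axioms_def monoid_def Units_def A_FactGroup_def FactGroup_def
    by (simp add: quotient_module_def A_RCOSETS_def set_add_def)
qed

text \<open>The least submodule of the factor module; comparing it with the greatest one decides
  whether the deviation is \<open>None\<close>.\<close>

lemma zero_submodule_quotient: "submodule {N} R (quotient_module M N)"
proof (intro submodule.intro submodule_axioms.intro)
  show "subgroup {N} (add_monoid (quotient_module M N))"
    using group.triv_subgroup[OF group_quotient_module] by (simp add: quotient_module_def)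
  fix a x assume a: "a \<in> carrier R" and x: "x \<in> {N}"
  have "N +>\<^bsub>M\<^esub> (a \<odot>\<^bsub>M\<^esub> y) = N" if "y \<in> N" for y
    using N.a_rcos_const[OF submoduleD(5)[OF N a that]] .
  then have "(\<Union>y\<in>N. N +>\<^bsub>M\<^esub> (a \<odot>\<^bsub>M\<^esub> y)) = N"
    using submoduleD(2)[OF N] by auto
  then show "a \<odot>\<^bsub>quotient_module M N\<^esub> x \<in> {N}"
    using x by (simp add: quotient_module_def)
qed

text \<open>The point is that scalar multiplication of cosets is well defined: for
  \<open>y = n \<oplus> x\<close> the difference of \<open>a \<odot> y\<close> and
  \<open>a \<odot> x\<close> is \<open>a \<odot> n \<in> N\<close>.\<close>

lemma carrier_submodule_quotient: "submodule (a_rcosets\<^bsub>M\<^esub> N) R (quotient_module M N)"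
proof (intro submodule.intro submodule_axioms.intro)
  show "subgroup (a_rcosets\<^bsub>M\<^esub> N) (add_monoid (quotient_module M N))"
    using group.subgroup_self[OF group_quotient_module] by (simp add: quotient_module_def)
  fix a c assume a: "a \<in> carrier R" and c: "c \<in> a_rcosets\<^bsub>M\<^esub> N"
  then obtain x where x: "x \<in> carrier M" "c = N +>\<^bsub>M\<^esub> x"
    by (auto simp: A_RCOSETS_def')
  have "N +>\<^bsub>M\<^esub> (a \<odot>\<^bsub>M\<^esub> y) = N +>\<^bsub>M\<^esub> (a \<odot>\<^bsub>M\<^esub> x)" if "y \<in> c" for y
  proof -
    obtain n where n: "n \<in> N" "y = n \<oplus>\<^bsub>M\<^esub> x"
      using \<open>y \<in> c\<close> x by (auto simp: a_r_coset_def')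
    have nM: "n \<in> carrier M" using n submoduleD(1)[OF N] by blast
    have "a \<odot>\<^bsub>M\<^esub> y = a \<odot>\<^bsub>M\<^esub> n \<oplus>\<^bsub>M\<^esub> a \<odot>\<^bsub>M\<^esub> x"
      using n nM x a smult_r_distr by simp
    moreover have "a \<odot>\<^bsub>M\<^esub> n \<in> N"
      using submoduleD(5)[OF N a n(1)] .
    ultimately have "a \<odot>\<^bsub>M\<^esub> y \<in> N +>\<^bsub>M\<^esub> (a \<odot>\<^bsub>M\<^esub> x)"
      by (auto simp: a_r_coset_def')
    then show ?thesis
      using N.a_repr_independence'[of "a \<odot>\<^bsub>M\<^esub> y" "a \<odot>\<^bsub>M\<^esub> x"] a x by auto
  qed
  \<comment> \<open>All terms of the union are the same coset, and nonemptiness of \<open>c\<close>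
    ensures that there is a term at all.\<close>
  moreover have "c \<noteq> {}"
    using a_rcosets_nonempty[OF c] .
  ultimately have "(\<Union>y\<in>c. N +>\<^bsub>M\<^esub> (a \<odot>\<^bsub>M\<^esub> y)) = N +>\<^bsub>M\<^esub> (a \<odot>\<^bsub>M\<^esub> x)"
    by auto
  then show "a \<odot>\<^bsub>quotient_module M N\<^esub> c \<in> a_rcosets\<^bsub>M\<^esub> N"
    using a x by (auto simp: quotient_module_def A_RCOSETS_def')
qed

lemma a_rcosets_eq_singleton_iff: "a_rcosets\<^bsub>M\<^esub> N = {N} \<longleftrightarrow> N = carrier M"
proof
  assume "a_rcosets\<^bsub>M\<^esub> N = {N}"
  then show "N = carrier M"
    using N.a_rcosets_part_G by simp
next
  assume "N = carrier M"
  then have "N +>\<^bsub>M\<^esub> x = N" if "x \<in> carrier M" for x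
    using that N.a_rcos_const by blast
  then show "a_rcosets\<^bsub>M\<^esub> N = {N}"
    by (auto simp: A_RCOSETS_def')
qed

end

end


section \<open>Modules with factor modules of finite length\<close>

text \<open>Isolates what the Euclidean function contributes. Finite length of the factor module is
  expressed by the interval above \<open>N\<close>, so that the arguments stay inside one lattice
  and avoid cosets.\<close>

locale infinite_length_finite_quotients = left_module +
  assumes finite_height_above:
      "nonzero_submodule N R M \<Longrightarrow> finite_height {L. submodule L R M \<and> N \<subseteq> L}"
    and infinite_height: "\<not> finite_height {N. submodule N R M}"
begin

lemma carrier_nonzero: "carrier M \<noteq> {\<zero>\<^bsub>M\<^esub>}"
proof
  assume "carrier M = {\<zero>\<^bsub>M\<^esub>}"
  then have "{N. submodule N R M} \<subseteq> Pow {\<zero>\<^bsub>M\<^esub>}"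
    using submoduleD(1) by blast
  then have "finite_height {N. submodule N R M}"
    by (intro finite_height_finite) (rule finite_subset, auto)
  then show False using infinite_height by blast
qed

text \<open>The map \<open>L \<mapsto> (L \<inter> N, L + N)\<close> is injective on comparable
  pairs by the modular law. Finite height both below and above \<open>N\<close> would give finite
  height of the whole lattice.\<close>

lemma infinite_height_below:
  assumes "nonzero_submodule N R M"
  shows "\<not> finite_height {L. submodule L R M \<and> L \<subseteq> N}"
proof
  assume below: "finite_height {L. submodule L R M \<and> L \<subseteq> N}"
  have N: "submodule N R M"
    using assms by (simp add: nonzero_submodule_def)
  have "finite_height {L. submodule L R M}"
  proof (rule finite_height_joint_map[OF below _ _ finite_height_above[OF assms]])
    show "(\<lambda>L. L \<inter> N) ` {L. submodule L R M} \<subseteq> {L. submodule L R M \<and> L \<subseteq> N}"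
      using submodule_Int[OF _ N] by blast
    show "mono_on {L. submodule L R M} (\<lambda>L. L \<inter> N)"
      by (auto simp: mono_on_def)
    show "(\<lambda>L. L <+>\<^bsub>M\<^esub> N) ` {L. submodule L R M} \<subseteq> {L. submodule L R M \<and> N \<subseteq> L}"
      using submodule_set_add[OF _ N] by blast
    show "mono_on {L. submodule L R M} (\<lambda>L. L <+>\<^bsub>M\<^esub> N)"
      unfolding mono_on_def set_add_def' by blast
    show "X = Y" if "X \<in> {L. submodule L R M}" "Y \<in> {L. submodule L R M}" "X \<subseteq> Y"
        "X \<inter> N = Y \<inter> N" "X <+>\<^bsub>M\<^esub> N = Y <+>\<^bsub>M\<^esub> N" for X Y
      using modular_law_eq[of X Y N] N that by blast
  qed
  then show False using infinite_height by blast
qed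

text \<open>If the intersection were zero, \<open>X \<mapsto> X + L\<close> would embed the interval
  below \<open>N\<close> into the one above \<open>L\<close>, as in the isomorphism of
  \<open>N\<close> with \<open>(N + L)/L\<close>. The latter has finite height, the former does
  not.\<close>

lemma Int_nonzero:
  assumes "nonzero_submodule N R M" "nonzero_submodule L R M"
  shows "N \<inter> L \<noteq> {\<zero>\<^bsub>M\<^esub>}"
proof
  assume disj: "N \<inter> L = {\<zero>\<^bsub>M\<^esub>}"
  have L: "submodule L R M"
    using assms by (simp add: nonzero_submodule_def)
  have "finite_height {X. submodule X R M \<and> X \<subseteq> N}"
  proof (rule finite_height_map[OF finite_height_above[OF assms(2)]])
    show "(\<lambda>X. X <+>\<^bsub>M\<^esub> L) ` {X. submodule X R M \<and> X \<subseteq> N} \<subseteq> {X. submodule X R M \<and> L \<subseteq> X}"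
      using submodule_set_add[OF _ L] by blast
    show "mono_on {X. submodule X R M \<and> X \<subseteq> N} (\<lambda>X. X <+>\<^bsub>M\<^esub> L)"
      unfolding mono_on_def set_add_def' by blast
    fix X Y assume XY: "X \<in> {X. submodule X R M \<and> X \<subseteq> N}" "Y \<in> {X. submodule X R M \<and> X \<subseteq> N}"
      "X \<subseteq> Y" "X <+>\<^bsub>M\<^esub> L = Y <+>\<^bsub>M\<^esub> L"
    \<comment> \<open>Equal intersections with \<open>L\<close>, as the modular law requires: both
      are zero.\<close>
    have "Z \<inter> L = {\<zero>\<^bsub>M\<^esub>}" if "submodule Z R M" "Z \<subseteq> N" for Z
      using submoduleD(2)[OF that(1)] submoduleD(2)[OF L] that(2) disj by blast
    then show "X = Y"
      using modular_law_eq[of X Y L] L XY by simp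
  qed
  then show False
    using infinite_height_below[OF assms(1)] by blast
qed

section \<open>Uniformity, indecomposability, socle and length of submodules\<close>

lemma uniform: "uniform_module R M"
  using Int_nonzero carrier_nonzero unfolding uniform_module_def by blast

lemma indecomposable: "indecomposable_module R M"
  using Int_nonzero carrier_nonzero unfolding indecomposable_module_def by blast

text \<open>Below a simple submodule there are only two submodules, contradicting
  \<open>infinite_height_below\<close>.\<close>

lemma not_simple_submodule: "\<not> simple_submodule S R M"
proof
  assume S: "simple_submodule S R M"
  have "L \<in> {{\<zero>\<^bsub>M\<^esub>}, S}" if "submodule L R M" "L \<subseteq> S" for L
    using S that unfolding simple_submodule_def nonzero_submodule_def by blast
  then have "{L. submodule L R M \<and> L \<subseteq> S} \<subseteq> {{\<zero>\<^bsub>M\<^esub>}, S}"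
    by blast
  then have "finite_height {L. submodule L R M \<and> L \<subseteq> S}"
    by (intro finite_height_finite) (rule finite_subset, auto)
  then show False
    using S infinite_height_below unfolding simple_submodule_def by blast
qed

text \<open>In the absence of simple submodules the socle is the intersection of all submodules, one
  of which is zero.\<close>

lemma socle_eq_zero: "socle R M = {\<zero>\<^bsub>M\<^esub>}"
  using not_simple_submodule zero_submodule submoduleD(2) unfolding socle_def by auto

lemma module_length_submodule:
  assumes "nonzero_submodule N R M"
  shows "module_length R (M\<lparr>carrier := N\<rparr>) = \<infinity>"
proof (rule ccontr)
  assume "module_length R (M\<lparr>carrier := N\<rparr>) \<noteq> \<infinity>"
  then have "finite_height {L. submodule L R (M\<lparr>carrier := N\<rparr>)}"
    by (simp flip: module_length_finite_iff)
  then have "finite_height {L. submodule L R M \<and> L \<subseteq> N}"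
    by (rule finite_height_subset) (use assms submodule_restrict in \<open>auto simp: nonzero_submodule_def\<close>)
  then show False using infinite_height_below[OF assms] by blast
qed

section \<open>Krull dimension and criticality\<close>

lemma not_artinian: "\<not> artinian_poset {N. submodule N R M}"
proof
  assume "artinian_poset {N. submodule N R M}"
  moreover have "{N. nonzero_submodule N R M} \<subseteq> {N. submodule N R M}"
    by (auto simp: nonzero_submodule_def)
  moreover have "carrier M \<in> {N. nonzero_submodule N R M}"
    using carrier_nonzero carrier_submodule by (simp add: nonzero_submodule_def)
  \<comment> \<open>A minimal nonzero submodule is simple, and there are none.\<close>
  ultimately obtain S where "nonzero_submodule S R M" "\<forall>N. nonzero_submodule N R M \<longrightarrow> \<not> N \<subset> S"
    using artinian_poset_minimal[of "{N. submodule N R M}" "{N. nonzero_submodule N R M}"] by auto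
  then have "simple_submodule S R M"
    unfolding simple_submodule_def by blast
  then show False using not_simple_submodule by blast
qed

text \<open>A descending sequence either reaches zero, after which its intervals are finite, or has
  only nonzero terms. In the second case each interval lies above a nonzero submodule and so has
  finite height.\<close>

lemma krull_dim: "has_krull_dim R M (Some (1 :: 'o ordinal))"
  unfolding has_krull_dim_def
proof (rule has_deviation_1I[OF not_artinian])
  fix f :: "nat \<Rightarrow> 'c set"
  let ?I = "\<lambda>i. {N \<in> {N. submodule N R M}. f (Suc i) \<subseteq> N \<and> N \<subseteq> f i}"
  assume f: "range f \<subseteq> {N. submodule N R M}" "antimono f"
  show "\<exists>n. \<forall>i\<ge>n. artinian_poset (?I i)"
  proof (cases "\<exists>n. f n = {\<zero>\<^bsub>M\<^esub>}")
    case True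
    then obtain n where n: "f n = {\<zero>\<^bsub>M\<^esub>}" by blast
    have "artinian_poset (?I i)" if "i \<ge> n" for i
    proof -
      have "?I i \<subseteq> Pow {\<zero>\<^bsub>M\<^esub>}"
        using n antimonoD[OF f(2) that] by auto
      then have "finite (?I i)"
        by (rule finite_subset) simp
      then show ?thesis
        by (intro finite_height_artinian finite_height_finite)
    qed
    then show ?thesis by blast
  next
    case False
    then have "nonzero_submodule (f (Suc i)) R M" for i
      using f(1) by (auto simp: nonzero_submodule_def)
    then have "finite_height (?I i)" for i
      by (rule finite_height_subset[OF finite_height_above]) auto
    then show ?thesis
      using finite_height_artinian by blast
  qed
qed

lemma module_length_quotient:
  assumes "nonzero_submodule N R M"
  shows "module_length R (quotient_module M N) < \<infinity>"
  using assms finite_height_above finite_height_quotient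
  unfolding module_length_finite_iff nonzero_submodule_def by blast

text \<open>Finite height gives the descending chain condition, so the deviation is
  \<open>Some 0\<close> unless the lattice is trivial. Triviality is tested on its least and
  greatest members.\<close>

lemma krull_dim_quotient:
  assumes "nonzero_submodule N R M"
  shows "has_krull_dim R (quotient_module M N) (if N = carrier M then None else Some (0 :: 'o ordinal))"
proof -
  let ?A = "{X. submodule X R (quotient_module M N)}"
  have N: "submodule N R M"
    using assms by (simp add: nonzero_submodule_def)
  have bounds: "{N} \<subseteq> X \<and> X \<subseteq> a_rcosets\<^bsub>M\<^esub> N" if "X \<in> ?A" for X
  proof -
    interpret X: submodule X R "quotient_module M N"
      using that by simp
    show ?thesis
      using X.subset X.one_closed by (simp add: quotient_module_def)
  qed
  have "has_deviation (None :: 'o ordinal option) ?A \<longleftrightarrow> N = carrier M"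
  proof
    assume "has_deviation (None :: 'o ordinal option) ?A"
    \<comment> \<open>\<open>None\<close> identifies comparable members only, so the two extremes
      have to be compared first.\<close>
    moreover have "{N} \<subseteq> a_rcosets\<^bsub>M\<^esub> N"
      using bounds[of "a_rcosets\<^bsub>M\<^esub> N"] carrier_submodule_quotient[OF N] by simp
    ultimately have "{N} = a_rcosets\<^bsub>M\<^esub> N"
      using zero_submodule_quotient[OF N] carrier_submodule_quotient[OF N]
      unfolding has_deviation_None_iff by simp
    then show "N = carrier M"
      using a_rcosets_eq_singleton_iff[OF N] by simp
  next
    assume "N = carrier M"
    then have "a_rcosets\<^bsub>M\<^esub> N = {N}"
      using a_rcosets_eq_singleton_iff[OF N] by simp
    then have "X = {N}" if "X \<in> ?A" for X
      using bounds[OF that] by auto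
    then show "has_deviation (None :: 'o ordinal option) ?A"
      unfolding has_deviation_None_iff by metis
  qed
  moreover have "artinian_poset ?A"
    using finite_height_artinian finite_height_quotient[OF N finite_height_above[OF assms]] by blast
  ultimately show ?thesis
    unfolding has_krull_dim_def by (cases "N = carrier M") (simp_all add: has_deviation_0_iff)
qed

lemma critical: "critical_module R M"
  unfolding critical_module_def
proof (intro exI conjI allI impI)
  \<comment> \<open>The witnesses are \<open>Some 1\<close> for \<open>M\<close> and
    \<open>None\<close> or \<open>Some 0\<close> for its factor modules; \<open>'c\<close> is the
    type of the elements of \<open>M\<close>.\<close>
  show "has_krull_dim R M (Some (1 :: 'c set ordinal))"
    by (rule krull_dim)
  fix N assume "nonzero_submodule N R M"
  then show "has_krull_dim R (quotient_module M N)
      (if N = carrier M then None else Some (0 :: 'c set ordinal))"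
    by (rule krull_dim_quotient)
  show "(if N = carrier M then None else Some (0 :: 'c set ordinal)) < Some 1"
    by simp
qed

end


section \<open>Euclidean modules\<close>

context left_module
begin

lemma euclidean_remainder_outside:
  assumes "euclidean_function R M d" "submodule N R M" "submodule L R M" "N \<subset> L"
    and "v \<in> N" "v \<noteq> \<zero>\<^bsub>M\<^esub>"
  obtains r where "r \<in> L - N" "d r < d v"
proof -
  note N = submoduleD[OF assms(2)] and L = submoduleD[OF assms(3)]
  obtain u where u: "u \<in> L" "u \<notin> N" using assms(4) by blast
  have uM: "u \<in> carrier M - {\<zero>\<^bsub>M\<^esub>}" and vM: "v \<in> carrier M - {\<zero>\<^bsub>M\<^esub>}"
    using u L(1) N(1,2) assms(5,6) by auto
  then obtain q r where qr: "q \<in> carrier R" "r \<in> carrier M" "u = q \<odot>\<^bsub>M\<^esub> v \<oplus>\<^bsub>M\<^esub> r"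
      "r = \<zero>\<^bsub>M\<^esub> \<or> d r < d v"
    using assms(1) unfolding euclidean_function_def by blast
  have qv: "q \<odot>\<^bsub>M\<^esub> v \<in> N"
    using N(5) qr(1) assms(5) by blast
  \<comment> \<open>Otherwise \<open>u\<close>, the sum of \<open>q \<odot> v\<close> and
    \<open>r\<close>, would lie in \<open>N\<close>.\<close>
  have "r \<notin> N"
    using N(3)[OF qv] u(2) qr(3) by blast
  moreover have "r = \<ominus>\<^bsub>M\<^esub> (q \<odot>\<^bsub>M\<^esub> v) \<oplus>\<^bsub>M\<^esub> u"
    using qr vM by (simp add: M.r_neg1)
  then have "r \<in> L"
    using qv u(1) assms(4) L(3,4) by blast
  \<comment> \<open>As \<open>\<zero> \<in> N\<close>, the remainder is nonzero, which leaves the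
    strict decrease.\<close>
  ultimately show thesis
    using that qr(4) N(2) by blast
qed

text \<open>The remainder found in the second module is the divisor for the rest of the chain. The
  modules grow while the values shrink, so the values appear in reverse order and \<open>d v\<close>
  comes last.\<close>

lemma euclidean_chain_values:
  assumes "euclidean_function R M d" "\<forall>L\<in>set (N # Ns). submodule L R M"
    and "sorted_wrt (\<subset>) (N # Ns)" "v \<in> N" "v \<noteq> \<zero>\<^bsub>M\<^esub>"
  shows "\<exists>xs. length xs = length (N # Ns) \<and> set xs \<subseteq> d ` (carrier M - {\<zero>\<^bsub>M\<^esub>}) \<and>
    sorted_wrt (<) xs \<and> last xs = d v"
  using assms(2-)
proof (induction Ns arbitrary: N v)
  case Nil
  then show ?case
    using submoduleD(1)[of N] by (intro exI[of _ "[d v]"]) auto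
next
  case (Cons L Ns)
  obtain r where r: "r \<in> L - N" "d r < d v"
    using euclidean_remainder_outside[OF assms(1), of N L v] Cons.prems by auto
  have "r \<noteq> \<zero>\<^bsub>M\<^esub>"
    using r submoduleD(2)[of N] Cons.prems(1) by auto
  then obtain xs where xs: "length xs = length (L # Ns)" "set xs \<subseteq> d ` (carrier M - {\<zero>\<^bsub>M\<^esub>})"
      "sorted_wrt (<) xs" "last xs = d r"
    using Cons.IH[of L r] Cons.prems r by auto
  have ne: "xs \<noteq> []" using xs(1) by auto
  have "x < d v" if "x \<in> set xs" for x
  proof -
    have "x \<le> last xs"
      using that xs(3) ne by (induction xs) (auto simp: less_imp_le)
    then show ?thesis using r(2) xs(4) by simp
  qed
  moreover have "d v \<in> d ` (carrier M - {\<zero>\<^bsub>M\<^esub>})"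
    using Cons.prems submoduleD(1)[of N] by auto
  ultimately show ?case
    using xs by (intro exI[of _ "xs @ [d v]"]) (auto simp: sorted_wrt_append)
qed

lemma euclidean_finite_height_above:
  assumes "euclidean_function R M d" "l_finite M d" "nonzero_submodule N R M"
  shows "finite_height {L. submodule L R M \<and> N \<subseteq> L}"
proof -
  let ?A = "d ` (carrier M - {\<zero>\<^bsub>M\<^esub>})"
  have N: "submodule N R M" "N \<noteq> {\<zero>\<^bsub>M\<^esub>}"
    using assms(3) by (auto simp: nonzero_submodule_def)
  \<comment> \<open>\<open>v\<close> lies in every submodule above \<open>N\<close>, so one bound,
    computed from \<open>d v\<close>, serves all chains.\<close>
  then obtain v where v: "v \<in> N" "v \<noteq> \<zero>\<^bsub>M\<^esub>"
    using submoduleD(2) by blast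
  \<comment> \<open>\<open>p\<close> is g(M), the lower end of the interval whose length gives the
    bound.\<close>
  obtain p where p: "p \<in> ?A" "\<And>a. a \<in> ?A \<Longrightarrow> p \<le> a"
    using assms(2) unfolding l_finite_def is_g_def by blast
  have dv: "d v \<in> ?A"
    using v submoduleD(1)[OF N(1)] by blast
  have "interval_length ?A p (d v) < \<infinity>"
    using assms(2) p dv unfolding l_finite_def Let_def by blast
  then obtain n where n: "interval_length ?A p (d v) = enat n"
    by (metis less_infinityE)
  show ?thesis
  proof (rule finite_heightI_sorted_list)
    fix Ns assume Ns: "set Ns \<subseteq> {L. submodule L R M \<and> N \<subseteq> L}" "sorted_wrt (\<subset>) Ns"
    show "length Ns \<le> n"
    proof (cases Ns)
      case (Cons L Ls)
      then obtain xs where xs: "length xs = length Ns" "set xs \<subseteq> ?A" "sorted_wrt (<) xs" "last xs = d v"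
      proof -
        have "\<forall>L'\<in>set (L # Ls). submodule L' R M" "sorted_wrt (\<subset>) (L # Ls)" "v \<in> L"
          using Ns v(1) Cons by auto
        then show thesis
          using that euclidean_chain_values[OF assms(1) _ _ _ v(2)] Cons by blast
      qed
      then obtain x xs' where x: "xs = x # xs'"
        using Cons by (cases xs) auto
      \<comment> \<open>Lists counted by \<open>interval_length\<close> begin with \<open>p\<close>,
        while the smallest value \<open>x\<close> obtained may lie strictly above it. As entries are
        counted, \<open>length xs \<le> length ys \<le> n\<close> holds without a
        correction.\<close>
      define ys where "ys = (if x = p then xs else p # xs)"
      have "p \<le> x" using p(2) xs(2) x by simp
      then have "ys \<noteq> []" "set ys \<subseteq> ?A" "sorted_wrt (<) ys" "hd ys = p" "last ys = d v"
        using xs x p(1) by (auto simp: ys_def)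
      then have "enat (length ys) \<le> interval_length ?A p (d v)"
        unfolding interval_length_def by (intro Sup_upper) blast
      then show ?thesis
        using n xs(1) by (auto simp: ys_def split: if_splits)
    qed simp
  qed
qed

end

theorem lemma2p8:
  fixes R :: "('r, 'x) ring_scheme"
    and M :: "('r, 'm, 'y) module_scheme"
    and d :: "'m \<Rightarrow> 'p::order"
  assumes "left_module R M"
    and "euclidean_function R M d"
    and "l_finite M d"
    and "module_length R M = \<infinity>"
  shows
    "uniform_module R M \<and>
     indecomposable_module R M \<and>
     socle R M = {\<zero>\<^bsub>M\<^esub>} \<and>
     (\<forall>N. nonzero_submodule N R M \<longrightarrow> module_length R (M\<lparr>carrier := N\<rparr>) = \<infinity>) \<and>
     has_krull_dim R M (Some (1 :: 'm set ordinal)) \<and>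
     (\<forall>N. nonzero_submodule N R M \<longrightarrow>
        module_length R (quotient_module M N) < \<infinity> \<and>
        has_krull_dim R (quotient_module M N)
          (if N = carrier M then None else Some (0 :: 'm set ordinal))) \<and>
     critical_module R M"
proof -
  interpret left_module R M by fact
  \<comment> \<open>The Euclidean function enters only through the finite height above each nonzero
    submodule.\<close>
  interpret infinite_length_finite_quotients R M
  proof
    show "finite_height {L. submodule L R M \<and> N \<subseteq> L}" if "nonzero_submodule N R M" for N
      using euclidean_finite_height_above assms(2,3) that by blast
    show "\<not> finite_height {N. submodule N R M}"
      using assms(4) module_length_finite_iff[of R M] by simp
  qed
  show ?thesis
    using uniform indecomposable socle_eq_zero module_length_submodule krull_dim
      module_length_quotient krull_dim_quotient critical by blast
qed

end
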